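(* Let $1<p<2$, $\frac1p+\frac1q=1$, $2<\alpha\le 3$, $\eta\in(0,1)$. Let $f\in C([0,1]\times[0,\infty),[0,\infty))$ with $f(t,0)\not\equiv 0$ on $[0,1]$, and let $a\in C([0,1],[0,\infty))$ with $a(t)\not\equiv0$ on any subinterval of $[0,1]$. Assume: (C1) there exists a nonnegative function $k\in C[0,1]$ such that $f(t,u)\le k(t)$ for any $(t,u)\in[0,1]\times[0,\infty)$; (C2) there exists a constant $L$ with $$0<L<\frac{\Gamma(\alpha+1)}{(\alpha+1)(q-1)}\Big(\int_0^1a(t)\,dt\Big)^{-1}\Big(\int_0^1a(t)k(t)\,dt\Big)^{2-q}$$ such that $|f(t,u)-f(t,v)|\le L|u-v|$ for any $t\in[0,1]$ and $u,v\in[0,\infty)$. Then the boundary value problem $$\big(\varphi_p(D^\alpha u(t))\big)'+a(t)f(t,u(t))=0,\quad t\in(0,1),$$ $$D^\alpha u(0)=u'(0)=u''(0)=0,\qquad u(1)+u'(1)=u'(\eta),$$ has a unique solution.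
   Context: For $r>1$, $\varphi_r(x)=|x|^{r-2}x$ (with $\varphi_r(0)=0$) is the $r$-Laplacian operator; $\varphi_q=\varphi_p^{-1}$ when $\frac1p+\frac1q=1$. Caputo derivative: for $u\in C^3([0,1])$ and $2<\alpha<3$, $D^\alpha u(t)=\frac{1}{\Gamma(3-\alpha)}\int_0^t(t-s)^{2-\alpha}u'''(s)\,ds$. For $u\in C^2([0,1])$ and $2<\alpha<3$, we use the equivalent (on $C^3$) form $D^\alpha u(t)=\frac{d}{dt}\Big[\frac{1}{\Gamma(3-\alpha)}\int_0^t(t-s)^{2-\alpha}\big(u''(s)-u''(0)\big)ds\Big]$ whenever this derivative exists (one-sided at the endpoints); for $\alpha=3$, $D^3u=u'''$. A solution of the boundary value problem is a function $u\in C^2([0,1],\mathbb R)$ with $u\ge0$ (as $f$ is defined only for $u\geq 0$) such that $D^\alpha u$ exists and is continuous on $[0,1]$, $\varphi_p(D^\alpha u)$ is differentiable on $(0,1)$, and the equation and boundary conditions hold. *)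

theory Defs
  imports "HOL-Analysis.Analysis"
begin

definition phi_lap :: "real \<Rightarrow> real \<Rightarrow> real" where
  "phi_lap r x = \<bar>x\<bar> powr (r - 2) * x"

text \<open>Derivative relative to $[0,1]$: one-sided at the endpoints, and dependent only on the
  values of the function on $[0,1]$.\<close>

definition deriv01 :: "(real \<Rightarrow> real) \<Rightarrow> real \<Rightarrow> real" where
  "deriv01 u t = vector_derivative u (at t within {0..1})"

definition C2_01 :: "(real \<Rightarrow> real) \<Rightarrow> bool" where
  "C2_01 u \<longleftrightarrow>
     u differentiable_on {0..1} \<and>
     deriv01 u differentiable_on {0..1} \<and>
     continuous_on {0..1} (deriv01 (deriv01 u))"

text \<open>The function whose derivative is the Caputo derivative of order $2 < \alpha \le 3$
  of a $C^2$ function. At the endpoint $s = t$ the kernel has the value $0$, which does not affect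
  the integral.\<close>

definition caputo_primitive :: "real \<Rightarrow> (real \<Rightarrow> real) \<Rightarrow> real \<Rightarrow> real" where
  "caputo_primitive \<alpha> u t =
     (if \<alpha> = 3 then deriv01 (deriv01 u) t
      else 1 / Gamma (3 - \<alpha>) *
        integral {0..t} (\<lambda>s. (t - s) powr (2 - \<alpha>) *
          (deriv01 (deriv01 u) s - deriv01 (deriv01 u) 0)))"

definition caputo_exists :: "real \<Rightarrow> (real \<Rightarrow> real) \<Rightarrow> bool" where
  "caputo_exists \<alpha> u \<longleftrightarrow> caputo_primitive \<alpha> u differentiable_on {0..1}"

definition caputo :: "real \<Rightarrow> (real \<Rightarrow> real) \<Rightarrow> real \<Rightarrow> real" where
  "caputo \<alpha> u = deriv01 (caputo_primitive \<alpha> u)"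

definition bvp_solution ::
  "real \<Rightarrow> real \<Rightarrow> real \<Rightarrow> (real \<Rightarrow> real) \<Rightarrow> (real \<Rightarrow> real \<Rightarrow> real) \<Rightarrow> (real \<Rightarrow> real) \<Rightarrow> bool" where
  "bvp_solution p \<alpha> \<eta> a f u \<longleftrightarrow>
     C2_01 u \<and>
     (\<forall>t\<in>{0..1}. 0 \<le> u t) \<and>
     caputo_exists \<alpha> u \<and>
     continuous_on {0..1} (caputo \<alpha> u) \<and>
     (\<forall>t\<in>{0<..<1}.
        (\<lambda>s. phi_lap p (caputo \<alpha> u s)) differentiable (at t) \<and>
        deriv (\<lambda>s. phi_lap p (caputo \<alpha> u s)) t + a t * f t (u t) = 0) \<and>
     caputo \<alpha> u 0 = 0 \<and>
     deriv01 u 0 = 0 \<and>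
     deriv01 (deriv01 u) 0 = 0 \<and>
     u 1 + deriv01 u 1 = deriv01 u \<eta>"

end

(* Write J^b for the Riemann-Liouville integral of order b (frac_int below). Its semigroup law
   J^d J^b = J^(d+b) on C[0,1] holds for monomials by the Beta integral and extends to all continuous
   functions by Weierstrass approximation, since J^b is bounded in the sup norm.
   With g = phi_q (integral of a f(s, u(s)) from 0 to t), the equation says that D^alpha u = -g, and
   integrating with the semigroup law turns the boundary value problem into the fixed point equation
     u(t) = J^alpha g (1) - J^alpha g (t) + J^(alpha-1) g (1) - J^(alpha-1) g (eta),
   whose right-hand side is nonnegative because J^b g increases for g >= 0, b > 1. As q > 2, the
   function x^(q-1) is Lipschitz on [0, int a k], so that the bound on L makes the right-hand side
   a contraction of C[0,1]. *)
theory Submission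
  imports Defs
begin

section \<open>Riemann-Liouville integrals of continuous functions\<close>

text \<open>Since \<open>0 powr x = 0\<close>, the kernel takes the value 0 at s = t whatever
  \<open>b\<close> is; this affects a single point only.\<close>

definition frac_int :: "real \<Rightarrow> (real \<Rightarrow> real) \<Rightarrow> real \<Rightarrow> real" where
  "frac_int b h t = integral {0..t} (\<lambda>s. (t - s) powr (b - 1) * h s) / Gamma b"

text \<open>The substitution s = t x reduces this to the Beta integral on [0,1]; the powers of t
  collect to \<open>t powr (b + c - 1)\<close>, and rescaling the interval supplies one more factor
  t.\<close>

lemma has_integral_frac_powr:
  fixes b c t :: real
  assumes "0 < b" "-1 < c" "0 \<le> t"
  shows "((\<lambda>s. (t - s) powr (b - 1) * s powr c) has_integral t powr (b + c) * Beta (c + 1) b) {0..t}"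
proof (cases "t = 0")
  case True
  then show ?thesis by (auto intro: has_integral_refl)
next
  case False
  with assms have t: "0 < t" by simp
  have "((\<lambda>x. x powr (c + 1 - 1) * (1 - x) powr (b - 1)) has_integral Beta (c + 1) b) (cbox 0 1)"
    using has_integral_Beta_real[of "c + 1" b] assms by simp
  from has_integral_affinity[OF this, of "1 / t" 0] t
  have "((\<lambda>x. (x / t) powr c * (1 - x / t) powr (b - 1)) has_integral t * Beta (c + 1) b) {0..t}"
    by (simp add: image_mult_atLeastAtMost)
  from has_integral_mult_right[OF this, of "t powr (b + c - 1)"]
  have "((\<lambda>x. t powr (b + c - 1) * ((x / t) powr c * (1 - x / t) powr (b - 1)))
          has_integral t powr (b + c) * Beta (c + 1) b) {0..t}"
    using t by (simp add: powr_diff)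
  moreover have "t powr (b + c - 1) * ((x / t) powr c * (1 - x / t) powr (b - 1))
      = (t - x) powr (b - 1) * x powr c" if "x \<in> {0..t}" for x
  proof -
    have "1 - x / t = (t - x) / t" using t by (simp add: field_simps)
    then have "(1 - x / t) powr (b - 1) = (t - x) powr (b - 1) / t powr (b - 1)"
      using that t by (simp add: powr_divide)
    moreover have "(x / t) powr c = x powr c / t powr c"
      using that t by (simp add: powr_divide)
    moreover have "t powr (b + c - 1) = t powr (b - 1) * t powr c"
      by (simp flip: powr_add add: algebra_simps)
    ultimately show ?thesis using t by simp
  qed
  ultimately show ?thesis
    by (rule has_integral_eq[rotated])
qed

text \<open>For b < 1 the kernel is singular at s = t, but it is nonnegative and integrable, and
  multiplication by the bounded measurable \<open>h\<close> preserves absolute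
  integrability.\<close>

lemma frac_kernel_absolutely_integrable:
  fixes b t :: real
  assumes "0 < b" "0 \<le> t" "continuous_on {0..t} h"
  shows "(\<lambda>s. (t - s) powr (b - 1) * h s) absolutely_integrable_on {0..t}"
proof -
  have "(\<lambda>s. (t - s) powr (b - 1) * s powr 0) integrable_on {0..t}"
    using has_integral_frac_powr[of b 0 t] assms by (auto simp: integrable_on_def)
  \<comment> \<open>The factor \<open>s powr 0\<close> is 1 except at s = 0, where
    \<open>0 powr 0 = 0\<close>.\<close>
  then have "(\<lambda>s. (t - s) powr (b - 1)) integrable_on {0..t}"
    by (rule integrable_spike[of _ _ "{0}"]) (auto)
  then have *: "(\<lambda>s. (t - s) powr (b - 1)) absolutely_integrable_on {0..t}"
    by (intro nonnegative_absolutely_integrable_1) auto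
  have "(\<lambda>s. h s * (t - s) powr (b - 1)) absolutely_integrable_on {0..t}"
  proof (rule absolutely_integrable_bounded_measurable_product_real[OF _ _ _ *])
    show "h \<in> borel_measurable (lebesgue_on {0..t})"
      by (intro continuous_imp_measurable_on_sets_lebesgue assms) auto
    show "bounded (h ` {0..t})"
      by (intro compact_imp_bounded compact_continuous_image assms) auto
  qed auto
  then show ?thesis by (simp add: mult.commute)
qed

lemma frac_kernel_integrable:
  fixes b t :: real
  assumes "0 < b" "0 \<le> t" "continuous_on {0..t} h"
  shows "(\<lambda>s. (t - s) powr (b - 1) * h s) integrable_on {0..t}"
  using frac_kernel_absolutely_integrable[OF assms] set_lebesgue_integral_eq_integral(1) by blast

section \<open>Monomials, linearity, order and bounds\<close>

lemma frac_int_cong: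
  assumes "\<And>s. 0 \<le> s \<Longrightarrow> s \<le> t \<Longrightarrow> g s = h s"
  shows "frac_int b g t = frac_int b h t"
  unfolding frac_int_def using assms by (auto intro!: arg_cong2[where f = "(/)"] integral_cong)

lemma frac_int_zero [simp]: "frac_int b h 0 = 0"
  by (simp add: frac_int_def)

lemma frac_int_powr:
  assumes "0 < b" "-1 < c" "0 \<le> t"
  shows "frac_int b (\<lambda>s. s powr c) t = Gamma (c + 1) / Gamma (c + b + 1) * t powr (c + b)"
proof -
  have "Gamma b > 0" using assms by (intro Gamma_real_pos)
  then show ?thesis
    using integral_unique[OF has_integral_frac_powr[OF assms]]
    by (simp add: frac_int_def Beta_def field_simps)
qed

lemma frac_int_cmult: "frac_int b (\<lambda>s. c * h s) t = c * frac_int b h t"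
  unfolding frac_int_def by (simp add: mult.left_commute[of _ c])

lemma frac_int_power:
  assumes "0 < b" "0 \<le> t"
  shows "frac_int b (\<lambda>s. s ^ n) t = fact n / Gamma (n + b + 1) * t powr (n + b)"
proof -
  \<comment> \<open>For n = 0 the two integrands differ at s = 0: \<open>0 ^ 0 = 1\<close>, but
    \<open>0 powr 0 = 0\<close>.\<close>
  have "frac_int b (\<lambda>s. s ^ n) t = frac_int b (\<lambda>s. s powr n) t"
    unfolding frac_int_def
    by (intro arg_cong2[where f = "(/)"] integral_spike[of "{0}"]) (auto simp: powr_realpow)
  then show ?thesis using frac_int_powr[of b n t] assms
    by (simp add: Gamma_fact add_ac)
qed

lemma frac_int_add:
  assumes "0 < b" "0 \<le> t" "continuous_on {0..t} g" "continuous_on {0..t} h"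
  shows "frac_int b (\<lambda>s. g s + h s) t = frac_int b g t + frac_int b h t"
  unfolding frac_int_def using assms
  by (simp add: distrib_left integral_add frac_kernel_integrable add_divide_distrib)

lemma frac_int_diff:
  assumes "0 < b" "0 \<le> t" "continuous_on {0..t} g" "continuous_on {0..t} h"
  shows "frac_int b (\<lambda>s. g s - h s) t = frac_int b g t - frac_int b h t"
  unfolding frac_int_def using assms
  by (simp add: right_diff_distrib integral_diff frac_kernel_integrable diff_divide_distrib)

lemma frac_int_sum:
  assumes "0 < b" "0 \<le> t" "finite I" "\<And>i. i \<in> I \<Longrightarrow> continuous_on {0..t} (h i)"
  shows "frac_int b (\<lambda>s. \<Sum>i\<in>I. h i s) t = (\<Sum>i\<in>I. frac_int b (h i) t)"
  using assms(3,4)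
proof (induction I)
  case empty
  then show ?case by (simp add: frac_int_def)
next
  case (insert i I)
  then show ?case
    using assms(1,2) by (simp add: frac_int_add continuous_on_sum)
qed

lemma frac_int_const:
  assumes "0 < b" "0 \<le> t"
  shows "frac_int b (\<lambda>s. c) t = c * t powr b / Gamma (b + 1)"
  using frac_int_cmult[of b c "\<lambda>s. s ^ 0" t] frac_int_power[OF assms, of 0] by simp

lemma frac_int_mono:
  assumes "0 < b" "0 \<le> t" "continuous_on {0..t} g" "continuous_on {0..t} h"
    and "\<And>s. 0 \<le> s \<Longrightarrow> s \<le> t \<Longrightarrow> g s \<le> h s"
  shows "frac_int b g t \<le> frac_int b h t"
proof -
  have "Gamma b > 0" using assms by (intro Gamma_real_pos)
  moreover have "integral {0..t} (\<lambda>s. (t - s) powr (b - 1) * g s)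
      \<le> integral {0..t} (\<lambda>s. (t - s) powr (b - 1) * h s)"
    using assms by (intro integral_le frac_kernel_integrable) (auto intro!: mult_left_mono)
  ultimately show ?thesis by (simp add: frac_int_def divide_right_mono)
qed

lemma frac_int_nonneg:
  assumes "0 < b" "0 \<le> t" "continuous_on {0..t} h" "\<And>s. 0 \<le> s \<Longrightarrow> s \<le> t \<Longrightarrow> 0 \<le> h s"
  shows "0 \<le> frac_int b h t"
  using frac_int_mono[of b t "\<lambda>_. 0" h] assms frac_int_const[of b t 0] by simp

lemma frac_int_abs_le:
  assumes "0 < b" "0 \<le> t" "continuous_on {0..t} h"
    and "\<And>s. 0 \<le> s \<Longrightarrow> s \<le> t \<Longrightarrow> \<bar>h s\<bar> \<le> e"
  shows "\<bar>frac_int b h t\<bar> \<le> e * t powr b / Gamma (b + 1)"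
proof -
  have "frac_int b h t \<le> frac_int b (\<lambda>_. e) t"
    using assms by (intro frac_int_mono) (auto simp: abs_le_iff)
  moreover have "frac_int b (\<lambda>_. - e) t \<le> frac_int b h t"
    using assms by (intro frac_int_mono) (auto simp: abs_le_iff minus_le_iff)
  ultimately show ?thesis
    using assms(1,2) by (simp add: frac_int_const abs_le_iff)
qed

text \<open>The kernel \<open>(t - s) powr 0\<close> equals 1 except at s = t, a null set.\<close>

lemma frac_int_one: "frac_int 1 h t = integral {0..t} h"
  unfolding frac_int_def by (simp, rule integral_spike[of "{t}"]) auto

text \<open>Since \<open>t powr b \<le> 1\<close> on [0,1], the bound is the same for all t. In this
  form uniform approximation passes through the fractional integral.\<close>

lemma frac_int_near:
  assumes "0 < b" "0 \<le> t" "t \<le> 1" "continuous_on {0..t} g" "continuous_on {0..t} h"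
    and "\<And>s. 0 \<le> s \<Longrightarrow> s \<le> t \<Longrightarrow> \<bar>g s - h s\<bar> \<le> e"
  shows "\<bar>frac_int b g t - frac_int b h t\<bar> \<le> e / Gamma (b + 1)"
proof -
  have "0 \<le> e" using assms(6)[of 0] assms(2) by simp
  have "Gamma (b + 1) > 0" using assms by (intro Gamma_real_pos) auto
  have "\<bar>frac_int b g t - frac_int b h t\<bar> \<le> e * t powr b / Gamma (b + 1)"
    using frac_int_abs_le[of b t "\<lambda>s. g s - h s" e] assms
    by (simp add: frac_int_diff continuous_on_diff)
  also have "\<dots> \<le> e * 1 / Gamma (b + 1)"
    using assms \<open>0 \<le> e\<close> \<open>Gamma (b + 1) > 0\<close>
    by (intro divide_right_mono mult_left_mono powr_le_one_le) (auto simp: powr_le1)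
  finally show ?thesis by simp
qed

lemma frac_int_polynomial:
  assumes "0 < b" "0 \<le> t"
  shows "frac_int b (\<lambda>s. \<Sum>i\<le>n. c i * s ^ i) t
      = (\<Sum>i\<le>n. c i * (fact i / Gamma (i + b + 1) * t powr (i + b)))"
  using assms
  by (simp add: frac_int_sum frac_int_cmult frac_int_power continuous_intros)

section \<open>Polynomial approximation: continuity and the semigroup law\<close>

lemma approx_by_polynomial:
  assumes "continuous_on {0..1} h" "0 < e"
  obtains c n where "\<And>s. s \<in> {0..1::real} \<Longrightarrow> \<bar>h s - (\<Sum>i\<le>n. c i * s ^ i)\<bar> \<le> e"
proof -
  obtain g where "real_polynomial_function g" "\<And>s. s \<in> {0..1} \<Longrightarrow> \<bar>h s - g s\<bar> < e"
    using Stone_Weierstrass_real_polynomial_function[of "{0..1}" h e] assms by auto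
  moreover from this(1) obtain c n where "g = (\<lambda>x. \<Sum>i\<le>n. c i * x ^ i)"
    by (auto simp: real_polynomial_function_iff_sum)
  ultimately show thesis using that[of c n] less_imp_le by blast
qed

text \<open>A uniform limit of continuous functions: for polynomials the fractional integral is an
  explicit sum of powers of t with positive exponents, and \<open>frac_int_near\<close> carries
  uniform convergence over.\<close>

lemma continuous_on_frac_int:
  assumes b: "0 < b" and h: "continuous_on {0..1} h"
  shows "continuous_on {0..1} (frac_int b h)"
proof -
  have "\<exists>c n. \<forall>s\<in>{0..1}. \<bar>h s - (\<Sum>i\<le>n. c i * s ^ i)\<bar> \<le> 1 / Suc m" for m
    using approx_by_polynomial[OF h, of "1 / Suc m"]
    by (metis of_nat_0_less_iff zero_less_Suc divide_pos_pos zero_less_one)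
  then obtain c n where P: "\<And>m s. s \<in> {0..1} \<Longrightarrow> \<bar>h s - (\<Sum>i\<le>n m. c m i * s ^ i)\<bar> \<le> 1 / Suc m"
    by metis
  define P where "P m s = (\<Sum>i\<le>n m. c m i * s ^ i)" for m s
  have "Gamma (b + 1) > 0" using assms by (intro Gamma_real_pos) auto
  have "uniform_limit {0..1} (\<lambda>m. frac_int b (P m)) (frac_int b h) sequentially"
  proof (rule uniform_limitI)
    fix e :: real assume "0 < e"
    have "(\<lambda>m. 1 / Suc m / Gamma (b + 1)) \<longlonglongrightarrow> 0 / Gamma (b + 1)"
      using \<open>Gamma (b + 1) > 0\<close>
      by (intro tendsto_divide LIMSEQ_Suc[OF lim_1_over_n] tendsto_const) auto
    then have "\<forall>\<^sub>F m in sequentially. 1 / Suc m / Gamma (b + 1) < e"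
      using \<open>0 < e\<close> by (intro order_tendstoD) auto
    then show "\<forall>\<^sub>F m in sequentially. \<forall>t\<in>{0..1}. dist (frac_int b (P m) t) (frac_int b h t) < e"
    proof eventually_elim
      case (elim m)
      show ?case
      proof
        fix t :: real assume t: "t \<in> {0..1}"
        have "\<bar>frac_int b h t - frac_int b (P m) t\<bar> \<le> 1 / Suc m / Gamma (b + 1)"
          using t P b by (intro frac_int_near continuous_on_subset[OF h])
            (auto simp: P_def intro!: continuous_intros)
        with elim show "dist (frac_int b (P m) t) (frac_int b h t) < e"
          by (simp add: dist_real_def abs_minus_commute)
      qed
    qed
  qed
  moreover have "continuous_on {0..1} (frac_int b (P m))" for m
  proof -
    have "continuous_on {0..1}
        (\<lambda>t. \<Sum>i\<le>n m. c m i * (fact i / Gamma (i + b + 1) * t powr (i + b)))"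
      using b by (intro continuous_intros continuous_on_powr') auto
    then show ?thesis
      unfolding P_def by (rule continuous_on_eq) (use b in \<open>simp only: frac_int_polynomial atLeastAtMost_iff\<close>)
  qed
  ultimately show ?thesis
    by (intro uniform_limit_theorem[of _ "\<lambda>m. frac_int b (P m)"]) auto
qed

text \<open>Passing to polynomials replaces an exchange of the order of integration of two singular
  kernels by an identity between Gamma quotients.\<close>

lemma frac_int_semigroup:
  assumes b: "0 < b" and d: "0 < d" and h: "continuous_on {0..1} h" and t: "t \<in> {0..1}"
  shows "frac_int d (frac_int b h) t = frac_int (d + b) h t"
proof -
  have pos: "Gamma (b + 1) > 0" "Gamma (d + 1) > 0" "Gamma (d + b + 1) > 0"
    using assms by (auto intro!: Gamma_real_pos)
  \<comment> \<open>Replacing \<open>h\<close> by a polynomial within e / C changes the iterated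
    integral by at most the first summand of \<open>C\<close>, and the single integral by at most
    the second, times e / C; together this is e.\<close>
  define C where "C = 1 / Gamma (b + 1) / Gamma (d + 1) + 1 / Gamma (d + b + 1)"
  have "C > 0" using pos by (simp add: C_def add_pos_pos)
  have "\<bar>frac_int d (frac_int b h) t - frac_int (d + b) h t\<bar> \<le> 0 + e" if "e > 0" for e
  proof -
    obtain c n where P: "\<And>s. s \<in> {0..1::real} \<Longrightarrow> \<bar>h s - (\<Sum>i\<le>n. c i * s ^ i)\<bar> \<le> e / C"
      using approx_by_polynomial[OF h, of "e / C"] \<open>e > 0\<close> \<open>C > 0\<close> by auto
    define P where "P s = (\<Sum>i\<le>n. c i * s ^ i)" for s
    have Pc: "continuous_on A P" for A unfolding P_def by (intro continuous_intros)
    have near: "\<bar>frac_int r h s - frac_int r P s\<bar> \<le> e / C / Gamma (r + 1)"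
      if "0 < r" "s \<in> {0..1}" for r s
      using that P Pc by (intro frac_int_near continuous_on_subset[OF h]) (auto simp: P_def)
    have "frac_int d (frac_int b P) t
        = frac_int d (\<lambda>s. \<Sum>i\<le>n. c i * (fact i / Gamma (i + b + 1) * s powr (i + b))) t"
      unfolding P_def by (intro frac_int_cong frac_int_polynomial b)
    also have "\<dots> = (\<Sum>i\<le>n. c i * (fact i / Gamma (i + b + 1) * frac_int d (\<lambda>s. s powr (i + b)) t))"
      unfolding frac_int_cmult[symmetric] using t d b
      by (intro frac_int_sum continuous_intros continuous_on_powr') auto
    also have "\<dots> = (\<Sum>i\<le>n. c i * (fact i / Gamma (i + (d + b) + 1) * t powr (i + (d + b))))"
    proof (rule sum.cong[OF refl])
      fix i
      \<comment> \<open>This Gamma value is the denominator from the inner integral and the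
        numerator from the outer one, so it cancels.\<close>
      have "Gamma (real i + b + 1) \<noteq> 0"
        using b by (intro less_imp_neq[THEN not_sym] Gamma_real_pos) auto
      then show "c i * (fact i / Gamma (i + b + 1) * frac_int d (\<lambda>s. s powr (i + b)) t)
          = c i * (fact i / Gamma (i + (d + b) + 1) * t powr (i + (d + b)))"
        using frac_int_powr[of d "i + b" t] b d t by (simp add: add_ac)
    qed
    also have "\<dots> = frac_int (d + b) P t"
      unfolding P_def using t b d by (subst frac_int_polynomial) auto
    finally have eq: "frac_int d (frac_int b P) t = frac_int (d + b) P t" .
    have "\<bar>frac_int d (frac_int b h) t - frac_int d (frac_int b P) t\<bar>
        \<le> e / C / Gamma (b + 1) / Gamma (d + 1)"
    proof (rule frac_int_near)
      show "continuous_on {0..t} (frac_int b h)"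
        by (rule continuous_on_subset[OF continuous_on_frac_int[OF b h]]) (use t in auto)
      show "continuous_on {0..t} (frac_int b P)"
        by (rule continuous_on_subset[OF continuous_on_frac_int[OF b Pc]]) (use t in auto)
    qed (use t d b near in auto)
    moreover have "\<bar>frac_int (d + b) h t - frac_int (d + b) P t\<bar> \<le> e / C / Gamma (d + b + 1)"
      using t b d by (intro near) auto
    ultimately have "\<bar>frac_int d (frac_int b h) t - frac_int (d + b) h t\<bar>
        \<le> e / C / Gamma (b + 1) / Gamma (d + 1) + e / C / Gamma (d + b + 1)"
      unfolding eq by linarith
    also have "\<dots> = e / C * C" by (simp add: C_def distrib_left)
    finally show ?thesis using \<open>C > 0\<close> by simp
  qed
  then have "\<bar>frac_int d (frac_int b h) t - frac_int (d + b) h t\<bar> \<le> 0"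
    by (rule field_le_epsilon)
  then show ?thesis by simp
qed

section \<open>Differentiation and monotonicity in the upper limit\<close>

lemma integral_frac_int:
  assumes "0 < b" "continuous_on {0..1} h" "t \<in> {0..1}"
  shows "integral {0..t} (frac_int b h) = frac_int (b + 1) h t"
  using assms frac_int_semigroup[of b 1 h t] by (simp add: frac_int_one add.commute)

lemma has_vector_derivative_frac_int:
  assumes "0 < b" "continuous_on {0..1} h" "t \<in> {0..1}"
  shows "(frac_int (b + 1) h has_vector_derivative frac_int b h t) (at t within {0..1})"
  using integral_has_vector_derivative[OF continuous_on_frac_int[OF assms(1,2)] assms(3)]
  by (rule has_vector_derivative_transform[rotated 2]) (use assms in \<open>auto simp: integral_frac_int\<close>)

text \<open>For b > 1 the fractional integral of order \<open>b\<close> is the ordinary integral of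
  the one of order b - 1, which is continuous and nonnegative.\<close>

lemma frac_int_mono_time:
  assumes "1 < b" "continuous_on {0..1} h" "\<And>s. s \<in> {0..1} \<Longrightarrow> 0 \<le> h s"
    and "0 \<le> s" "s \<le> t" "t \<le> 1"
  shows "frac_int b h s \<le> frac_int b h t"
proof -
  have c: "continuous_on {0..t} (frac_int (b - 1) h)"
    using assms by (intro continuous_on_subset[OF continuous_on_frac_int[of "b - 1" h]]) auto
  have "integral {0..s} (frac_int (b - 1) h) \<le> integral {0..t} (frac_int (b - 1) h)"
  proof (rule integral_subset_le)
    show "frac_int (b - 1) h integrable_on {0..s}" "frac_int (b - 1) h integrable_on {0..t}"
      using assms by (auto intro!: integrable_continuous_real continuous_on_subset[OF c])
    show "\<forall>x\<in>{0..t}. 0 \<le> frac_int (b - 1) h x"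
      using assms by (auto intro!: frac_int_nonneg continuous_on_subset[OF assms(2)])
  qed (use assms in auto)
  then show ?thesis
    using assms integral_frac_int[of "b - 1" h s] integral_frac_int[of "b - 1" h t] by simp
qed

text \<open>Monotonicity applied to the nonnegative functions e + h and e - h bounds the increment
  by that of the constant e. Estimating the two values separately would double the constant, too
  much for the contraction estimate.\<close>

lemma frac_int_increment_abs_le:
  assumes "1 < b" "continuous_on {0..1} h" "\<And>s. s \<in> {0..1} \<Longrightarrow> \<bar>h s\<bar> \<le> e"
    and "0 \<le> s" "s \<le> t" "t \<le> 1"
  shows "\<bar>frac_int b h t - frac_int b h s\<bar> \<le> e / Gamma (b + 1)"
proof -
  have "0 \<le> e" using assms(3)[of 0] by simp
  have G: "Gamma (b + 1) > 0" using assms by (intro Gamma_real_pos) auto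
  have h: "continuous_on {0..r} h" if "r \<le> 1" for r
    using that by (intro continuous_on_subset[OF assms(2)]) auto
  have 1: "frac_int b (\<lambda>x. e + h x) s \<le> frac_int b (\<lambda>x. e + h x) t"
  proof (intro frac_int_mono_time continuous_intros)
    show "0 \<le> e + h x" if "x \<in> {0..1}" for x
      using assms(3)[OF that] by linarith
  qed (use assms in auto)
  have 2: "frac_int b (\<lambda>x. e - h x) s \<le> frac_int b (\<lambda>x. e - h x) t"
    using assms by (intro frac_int_mono_time continuous_intros) (auto simp: abs_le_iff)
  have "e * t powr b / Gamma (b + 1) \<le> e * 1 / Gamma (b + 1)"
    using assms \<open>0 \<le> e\<close> G
    by (intro divide_right_mono mult_left_mono) (auto simp: powr_le1)
  moreover have "e * s powr b / Gamma (b + 1) \<ge> 0"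
    using \<open>0 \<le> e\<close> G by simp
  ultimately show ?thesis
    using 1 2 assms h by (simp add: frac_int_add frac_int_diff frac_int_const abs_le_iff)
qed

section \<open>Caputo initial value problems\<close>

lemma deriv01_eqI:
  assumes "(u has_vector_derivative d) (at t within {0..1})" "t \<in> {0..1}"
  shows "deriv01 u t = d"
  unfolding deriv01_def
  using vector_derivative_within_closed_interval[of 0 1 t u d] assms by auto

lemma has_vector_derivative_deriv01:
  assumes "u differentiable_on {0..1}" "t \<in> {0..1}"
  shows "(u has_vector_derivative deriv01 u t) (at t within {0..1})"
  using assms unfolding deriv01_def differentiable_on_def
  by (simp add: vector_derivative_works)

lemma integral_deriv01:
  assumes "u differentiable_on {0..1}" "t \<in> {0..1}"
  shows "integral {0..t} (deriv01 u) = u t - u 0"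
  using assms
  by (intro integral_unique fundamental_theorem_of_calculus)
    (auto intro!: has_vector_derivative_within_subset[OF has_vector_derivative_deriv01])

lemma has_vector_derivative_cong01:
  assumes "\<And>s. s \<in> {0..1} \<Longrightarrow> u s = v s" "t \<in> {0..1}"
    "(v has_vector_derivative d) (at t within {0..1})"
  shows "(u has_vector_derivative d) (at t within {0..1})"
  using assms by (intro has_vector_derivative_transform[of t "{0..1}" u v]) auto

text \<open>For \<alpha> < 3, with J^b for \<open>frac_int b\<close>, u' = J^1 u'' = J^(\<alpha>-2)
  J^(3-\<alpha>) u'' = J^(\<alpha>-2) J^1 g = J^(\<alpha>-1) g. Aiming at u' instead of u'' avoids
  inverting a fractional integral. For \<alpha> = 3 the Caputo primitive is u'' itself.\<close>

lemma caputo_initial_value_imp: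
  assumes \<alpha>: "2 < \<alpha>" "\<alpha> \<le> 3" and u: "C2_01 u" "deriv01 u 0 = 0" "deriv01 (deriv01 u) 0 = 0"
    and ex: "caputo_exists \<alpha> u"
    and g: "continuous_on {0..1} g" "\<And>t. t \<in> {0..1} \<Longrightarrow> caputo \<alpha> u t = g t"
    and t: "t \<in> {0..1}"
  shows "deriv01 u t = frac_int (\<alpha> - 1) g t" "u t = u 0 + frac_int \<alpha> g t"
proof -
  define u2 where "u2 = deriv01 (deriv01 u)"
  have C2: "u differentiable_on {0..1}" "deriv01 u differentiable_on {0..1}"
    and c2: "continuous_on {0..1} u2" and "u2 0 = 0"
    using u by (auto simp: C2_01_def u2_def)
  have prim: "caputo_primitive \<alpha> u r = frac_int 1 g r" if r: "r \<in> {0..1}" for r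
  proof -
    have "caputo_primitive \<alpha> u 0 = 0"
      using \<open>u2 0 = 0\<close> by (simp add: caputo_primitive_def u2_def)
    then have "caputo_primitive \<alpha> u r = integral {0..r} (caputo \<alpha> u)"
      using integral_deriv01[of "caputo_primitive \<alpha> u" r] ex r
      by (simp add: caputo_exists_def caputo_def)
    also have "\<dots> = integral {0..r} g"
      using r g by (intro integral_cong) auto
    also have "\<dots> = frac_int 1 g r"
      by (simp add: frac_int_one)
    finally show ?thesis .
  qed
  have u1_int: "deriv01 u r = integral {0..r} u2" if "r \<in> {0..1}" for r
    using integral_deriv01[OF C2(2) that] u by (simp add: u2_def)
  have u1: "deriv01 u r = frac_int (\<alpha> - 1) g r" if r: "r \<in> {0..1}" for r
  proof (cases "\<alpha> = 3")
    case True
    have "deriv01 u r = integral {0..r} (frac_int 1 g)"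
      unfolding u1_int[OF r] using prim r True
      by (intro integral_cong) (auto simp: caputo_primitive_def u2_def)
    then show ?thesis using True g r by (simp add: integral_frac_int)
  next
    case False
    have "deriv01 u r = frac_int 1 u2 r"
      using u1_int[OF r] by (simp add: frac_int_one)
    also have "\<dots> = frac_int (\<alpha> - 2) (frac_int (3 - \<alpha>) u2) r"
      using False \<alpha> c2 r by (simp add: frac_int_semigroup)
    \<comment> \<open>As u''(0) = 0, the Caputo primitive is exactly the fractional integral of
      order 3 - \<alpha> of u''.\<close>
    also have "\<dots> = frac_int (\<alpha> - 2) (frac_int 1 g) r"
      using prim r False \<open>u2 0 = 0\<close>
      by (intro frac_int_cong) (auto simp: caputo_primitive_def frac_int_def u2_def)
    also have "\<dots> = frac_int (\<alpha> - 1) g r"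
      using \<alpha> g r by (simp add: frac_int_semigroup)
    finally show ?thesis .
  qed
  then show "deriv01 u t = frac_int (\<alpha> - 1) g t" using t by simp
  have "u t - u 0 = integral {0..t} (frac_int (\<alpha> - 1) g)"
    unfolding integral_deriv01[OF C2(1) t, symmetric] using t u1 by (intro integral_cong) auto
  then show "u t = u 0 + frac_int \<alpha> g t" using \<alpha> g t by (simp add: integral_frac_int)
qed

text \<open>Two differentiations lower the order to \<alpha> - 2, so u'' vanishes at 0; the
  semigroup law with the remaining order 3 - \<alpha> makes the Caputo primitive the ordinary
  integral of \<open>g\<close>. For \<alpha> = 3, u'' is already that integral.\<close>

lemma caputo_initial_value_solution:
  assumes \<alpha>: "2 < \<alpha>" "\<alpha> \<le> 3" and g: "continuous_on {0..1} g"
    and u_eq: "\<forall>t\<in>{0..1}. u t = c + frac_int \<alpha> g t"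
  shows "C2_01 u" "caputo_exists \<alpha> u"
    "\<And>t. t \<in> {0..1} \<Longrightarrow> caputo \<alpha> u t = g t"
    "\<And>t. t \<in> {0..1} \<Longrightarrow> deriv01 u t = frac_int (\<alpha> - 1) g t"
    "\<And>t. t \<in> {0..1} \<Longrightarrow> deriv01 (deriv01 u) t = frac_int (\<alpha> - 2) g t"
proof -
  have u: "u t = c + frac_int \<alpha> g t" if "t \<in> {0..1}" for t
    using u_eq that by blast
  have v0: "(u has_vector_derivative frac_int (\<alpha> - 1) g t) (at t within {0..1})"
    if "t \<in> {0..1}" for t
  proof (rule has_vector_derivative_cong01[OF u that])
    show "((\<lambda>t. c + frac_int \<alpha> g t) has_vector_derivative frac_int (\<alpha> - 1) g t) (at t within {0..1})"
      using has_vector_derivative_frac_int[of "\<alpha> - 1" g t] \<alpha> g that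
        has_vector_derivative_add[OF has_vector_derivative_const] by force
  qed
  then show u1: "deriv01 u t = frac_int (\<alpha> - 1) g t" if "t \<in> {0..1}" for t
    using that deriv01_eqI by blast
  have v1: "(deriv01 u has_vector_derivative frac_int (\<alpha> - 2) g t) (at t within {0..1})"
    if "t \<in> {0..1}" for t
    using has_vector_derivative_frac_int[of "\<alpha> - 2" g t] \<alpha> g that
    by (intro has_vector_derivative_cong01[OF u1]) (auto simp: algebra_simps)
  then show u2: "deriv01 (deriv01 u) t = frac_int (\<alpha> - 2) g t" if "t \<in> {0..1}" for t
    using that deriv01_eqI by blast
  have diff: "h differentiable_on {0..1}"
    if "\<And>t. t \<in> {0..1} \<Longrightarrow> (h has_vector_derivative d t) (at t within {0..1})" for h d
    using that unfolding differentiable_on_def by (blast intro: differentiableI_vector)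
  have "continuous_on {0..1} (deriv01 (deriv01 u))"
    using continuous_on_eq[OF continuous_on_frac_int[of "\<alpha> - 2" g]] \<alpha> g u2 by simp
  then show "C2_01 u" unfolding C2_01_def using diff[OF v0] diff[OF v1] by blast
  have prim: "caputo_primitive \<alpha> u t = integral {0..t} g" if t: "t \<in> {0..1}" for t
  proof -
    have "caputo_primitive \<alpha> u t = frac_int 1 g t"
    proof (cases "\<alpha> = 3")
      case True
      then show ?thesis using t u2 by (simp add: caputo_primitive_def)
    next
      case False
      have "caputo_primitive \<alpha> u t = frac_int (3 - \<alpha>) (deriv01 (deriv01 u)) t"
        using False u2[of 0] by (simp add: caputo_primitive_def frac_int_def)
      also have "\<dots> = frac_int (3 - \<alpha>) (frac_int (\<alpha> - 2) g) t"
        using t u2 by (intro frac_int_cong) auto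
      also have "\<dots> = frac_int 1 g t"
        using False \<alpha> t g by (simp add: frac_int_semigroup)
      finally show ?thesis .
    qed
    then show ?thesis by (simp add: frac_int_one)
  qed
  have w: "(caputo_primitive \<alpha> u has_vector_derivative g t) (at t within {0..1})"
    if "t \<in> {0..1}" for t
    using prim that integral_has_vector_derivative[OF g that]
    by (rule has_vector_derivative_cong01)
  then show "caputo \<alpha> u t = g t" if "t \<in> {0..1}" for t
    using that unfolding caputo_def by (auto intro: deriv01_eqI)
  show "caputo_exists \<alpha> u"
    unfolding caputo_exists_def by (rule diff[OF w])
qed

section \<open>The boundary value problem as a fixed point equation\<close>

lemma phi_lap_nonneg_eq: "0 \<le> x \<Longrightarrow> phi_lap r x = x powr (r - 1)"
  by (cases "x = 0") (auto simp: phi_lap_def powr_diff power2_eq_square)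

lemma phi_lap_minus: "phi_lap r (- x) = - phi_lap r x"
  by (simp add: phi_lap_def)

text \<open>Conjugacy means (q - 1) (p - 1) = 1, so the powers cancel on nonnegative arguments;
  oddness gives the rest.\<close>

lemma phi_lap_inverse:
  assumes "1 < p" "1 / p + 1 / q = 1"
  shows "phi_lap p (phi_lap q x) = x"
proof -
  \<comment> \<open>With q = 0 the term \<open>1 / q\<close> would be 0, forcing p = 1.\<close>
  have "q \<noteq> 0" using assms by auto
  then have "q + p = p * q" using assms by (simp add: field_simps)
  then have pq: "(q - 1) * (p - 1) = 1" by (simp add: algebra_simps)
  have "phi_lap p (phi_lap q y) = y" if "0 \<le> y" for y
    using that pq by (simp add: phi_lap_nonneg_eq powr_powr)
  from this[of x] this[of "- x"] show ?thesis
    by (cases "0 \<le> x") (auto simp: phi_lap_minus)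
qed

text \<open>For r < 2 the factor \<open>\<bar>x\<bar> powr (r - 2)\<close> blows up at 0. Splitting
  into positive and negative parts leaves only the positive exponent r - 1.\<close>

lemma continuous_on_phi_lap:
  assumes "1 < r" "continuous_on A w"
  shows "continuous_on A (\<lambda>x. phi_lap r (w x))"
proof -
  have "phi_lap r y = (max 0 y) powr (r - 1) - (max 0 (- y)) powr (r - 1)" for y
    using phi_lap_nonneg_eq[of y r] phi_lap_nonneg_eq[of "- y" r] by (auto simp: phi_lap_minus max_def)
  then show ?thesis
    using assms by (auto intro!: continuous_intros continuous_on_powr')
qed

lemma powr_diff_abs_le:
  fixes x y m K :: real
  assumes "1 < m" "0 \<le> x" "x \<le> K" "0 \<le> y" "y \<le> K"
  shows "\<bar>x powr m - y powr m\<bar> \<le> m * K powr (m - 1) * \<bar>x - y\<bar>"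
proof -
  have *: "\<bar>y powr m - x powr m\<bar> \<le> m * K powr (m - 1) * \<bar>y - x\<bar>"
    if "0 \<le> x" "x < y" "y \<le> K" for x y
  proof -
    have "continuous_on {x..y} (\<lambda>z. z powr m)"
      using that assms by (intro continuous_on_powr' continuous_intros) auto
    moreover have "((\<lambda>z. z powr m) has_derivative (\<lambda>h. h * (m * z powr (m - 1)))) (at z)"
      if "x < z" "z < y" for z
      using \<open>0 \<le> x\<close> that
        has_real_derivative_powr[of z m] by (simp add: has_field_derivative_def mult.commute[of _ "m * _"])
    ultimately obtain z where z: "x < z" "z < y" "y powr m - x powr m = (y - x) * (m * z powr (m - 1))"
      using mvt[OF \<open>x < y\<close>, of "\<lambda>z. z powr m" "\<lambda>z h. h * (m * z powr (m - 1))"] by metis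
    have "z powr (m - 1) \<le> K powr (m - 1)"
      using z that assms by (intro powr_mono2) auto
    then have "(y - x) * (m * z powr (m - 1)) \<le> (y - x) * (m * K powr (m - 1))"
      using that assms by (intro mult_left_mono) auto
    moreover have "0 \<le> (y - x) * (m * z powr (m - 1))" using that assms by simp
    ultimately show ?thesis using z(3) \<open>x < y\<close> by (simp add: mult.commute)
  qed
  show ?thesis
    using *[of x y] *[of y x] assms by (cases x y rule: linorder_cases) (auto simp: abs_minus_commute)
qed

section \<open>Integrals with variable upper limit and the complete space\<close>

lemma continuous_on_integral_upto:
  fixes h :: "real \<Rightarrow> real"
  assumes "continuous_on {0..1} h"
  shows "continuous_on {0..1} (\<lambda>t. integral {0..t} h)"
  using assms by (intro indefinite_integral_continuous_1 integrable_continuous_real)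

lemma integrable_sub01:
  fixes h :: "real \<Rightarrow> real"
  assumes "continuous_on {0..1} h" "t \<in> {0..1}"
  shows "h integrable_on {0..t}"
  using assms by (intro integrable_continuous_real continuous_on_subset[OF assms(1)]) auto

lemma integral_upto_le:
  fixes h :: "real \<Rightarrow> real"
  assumes "continuous_on {0..1} h" "t \<in> {0..1}" "\<And>s. s \<in> {0..1} \<Longrightarrow> 0 \<le> h s"
  shows "integral {0..t} h \<le> integral {0..1} h"
  using assms by (intro integral_subset_le integrable_sub01) auto

text \<open>Extending by the boundary values embeds $C[0,1]$ into a type of class
  \<open>complete_space\<close>, where the Banach fixed point theorem applies.\<close>

definition bcontfun01 :: "(real \<Rightarrow> real) \<Rightarrow> (real \<Rightarrow>\<^sub>C real)" where
  "bcontfun01 h = Bcontfun (\<lambda>t. h (max 0 (min 1 t)))"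

lemma bcontfun01_apply:
  assumes "continuous_on {0..1} h"
  shows "apply_bcontfun (bcontfun01 h) t = h (max 0 (min 1 t))"
proof -
  have c: "continuous_on UNIV (\<lambda>t. h (max 0 (min 1 t)))"
    by (rule continuous_on_compose2[OF assms]) (auto intro!: continuous_intros)
  have "bounded (h ` {0..1})"
    by (intro compact_imp_bounded compact_continuous_image assms) auto
  then have "bounded (range (\<lambda>t. h (max 0 (min 1 t))))"
    by (rule bounded_subset) auto
  with c show ?thesis
    unfolding bcontfun01_def by (subst Bcontfun_inverse) (auto simp: bcontfun_def)
qed

section \<open>The integral operator and its contraction estimate\<close>

locale laplacian_bvp =
  fixes p q \<alpha> \<eta> L :: real
    and f :: "real \<Rightarrow> real \<Rightarrow> real"
    and a k :: "real \<Rightarrow> real"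
  assumes p: "1 < p" "p < 2" and pq: "1 / p + 1 / q = 1"
    and \<alpha>: "2 < \<alpha>" "\<alpha> \<le> 3"
    and \<eta>: "\<eta> \<in> {0<..<1}"
    and f_cont: "continuous_on ({0..1} \<times> {0..}) (\<lambda>(t, u). f t u)"
    and f_nonneg: "\<And>t u. t \<in> {0..1} \<Longrightarrow> 0 \<le> u \<Longrightarrow> 0 \<le> f t u"
    and a_cont: "continuous_on {0..1} a"
    and a_nonneg: "\<And>t. t \<in> {0..1} \<Longrightarrow> 0 \<le> a t"
    and k_cont: "continuous_on {0..1} k"
    and f_le: "\<And>t u. t \<in> {0..1} \<Longrightarrow> 0 \<le> u \<Longrightarrow> f t u \<le> k t"
    and L_pos: "0 < L"
    and f_lipschitz: "\<And>t u v. t \<in> {0..1} \<Longrightarrow> 0 \<le> u \<Longrightarrow> 0 \<le> v \<Longrightarrow> \<bar>f t u - f t v\<bar> \<le> L * \<bar>u - v\<bar>"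
begin

text \<open>Truncation at 0 because \<open>f\<close> is controlled on nonnegative arguments only; it has no effect on
  solutions and on fixed points, which are nonnegative.\<close>

definition source :: "(real \<Rightarrow> real) \<Rightarrow> real \<Rightarrow> real" where
  "source u t = a t * f t (max 0 (u t))"

text \<open>The negative of the Caputo derivative of a solution: the equation is integrated from 0,
  where that derivative vanishes, and \<open>phi_lap p\<close> is inverted.\<close>

definition flux :: "(real \<Rightarrow> real) \<Rightarrow> real \<Rightarrow> real" where
  "flux u t = phi_lap q (integral {0..t} (source u))"

text \<open>With u = u(0) - J^\<alpha> g and u' = -J^(\<alpha>-1) g, the condition u(1) + u'(1) =
  u'(\<eta>) determines u(0). The terms are grouped into two increments, each of which is
  nonnegative.\<close>

definition solution_op :: "(real \<Rightarrow> real) \<Rightarrow> real \<Rightarrow> real" where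
  "solution_op u t = frac_int \<alpha> (flux u) 1 - frac_int \<alpha> (flux u) t
     + (frac_int (\<alpha> - 1) (flux u) 1 - frac_int (\<alpha> - 1) (flux u) \<eta>)"

text \<open>The first factor is 1 / Gamma (\<alpha> + 1) + 1 / Gamma \<alpha>, from the two
  increments; then come the Lipschitz constant of x^(q-1) on the range of the integrated source, and
  that of the integrated source in u.\<close>

definition contraction_const :: real where
  "contraction_const = (\<alpha> + 1) / Gamma (\<alpha> + 1) * ((q - 1)
     * integral {0..1} (\<lambda>t. a t * k t) powr (q - 2) * (L * integral {0..1} a))"

lemma q_gt_2: "2 < q"
proof -
  have "q \<noteq> 0" using pq p by auto
  have "1 / q = 1 - 1 / p" using pq by simp
  moreover have "0 < 1 - 1 / p" "1 - 1 / p < 1 / 2" using p by (auto simp: field_simps)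
  ultimately have "0 < 1 / q" "1 / q < 1 / 2" by auto
  then show ?thesis using \<open>q \<noteq> 0\<close> by (simp add: field_simps)
qed

lemma continuous_on_source:
  assumes "continuous_on {0..1} u"
  shows "continuous_on {0..1} (source u)"
proof -
  have "continuous_on {0..1} (\<lambda>t. (\<lambda>(t, u). f t u) (t, max 0 (u t)))"
    by (rule continuous_on_compose2[OF f_cont]) (use assms in \<open>auto intro!: continuous_intros\<close>)
  then show ?thesis
    unfolding source_def by (auto intro!: continuous_intros a_cont)
qed

lemma source_bounds:
  assumes "t \<in> {0..1}"
  shows "0 \<le> source u t" "source u t \<le> a t * k t"
  using assms a_nonneg f_nonneg f_le by (auto simp: source_def intro!: mult_left_mono)

text \<open>The upper bound is independent of \<open>u\<close>, so one Lipschitz constant of x^(q-1)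
  serves all fluxes.\<close>

lemma integral_source_bounds:
  assumes "continuous_on {0..1} u" "t \<in> {0..1}"
  shows "0 \<le> integral {0..t} (source u)"
    "integral {0..t} (source u) \<le> integral {0..1} (\<lambda>t. a t * k t)"
proof -
  note c = continuous_on_source[OF assms(1)]
  show "0 \<le> integral {0..t} (source u)"
    using assms by (intro integral_nonneg integrable_sub01 c) (auto intro!: source_bounds)
  have "integral {0..t} (source u) \<le> integral {0..1} (source u)"
    using assms by (intro integral_upto_le c source_bounds) auto
  also have "\<dots> \<le> integral {0..1} (\<lambda>t. a t * k t)"
    using source_bounds
    by (intro integral_le integrable_sub01 c continuous_intros a_cont k_cont) auto
  finally show "integral {0..t} (source u) \<le> integral {0..1} (\<lambda>t. a t * k t)" .
qed

lemma continuous_on_flux: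
  assumes "continuous_on {0..1} u"
  shows "continuous_on {0..1} (flux u)"
  unfolding flux_def using q_gt_2 assms
  by (intro continuous_on_phi_lap continuous_on_integral_upto continuous_on_source) auto

lemma flux_eq_powr:
  assumes "continuous_on {0..1} u" "t \<in> {0..1}"
  shows "flux u t = integral {0..t} (source u) powr (q - 1)"
  unfolding flux_def using integral_source_bounds[OF assms] by (simp add: phi_lap_nonneg_eq)

lemma continuous_on_solution_op:
  assumes "continuous_on {0..1} u"
  shows "continuous_on {0..1} (solution_op u)"
proof -
  have "continuous_on {0..1} (frac_int \<alpha> (flux u))"
    using \<alpha> assms by (intro continuous_on_frac_int continuous_on_flux) auto
  then show ?thesis unfolding solution_op_def by (intro continuous_intros)
qed

text \<open>Both orders \<alpha> and \<alpha> - 1 exceed 1, so both increments of the nonnegative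
  flux are nonnegative.\<close>

lemma solution_op_nonneg:
  assumes u: "continuous_on {0..1} u" and t: "t \<in> {0..1}"
  shows "0 \<le> solution_op u t"
proof -
  have "frac_int \<alpha> (flux u) t \<le> frac_int \<alpha> (flux u) 1"
    using \<alpha> t by (intro frac_int_mono_time continuous_on_flux u) (auto simp: flux_eq_powr[OF u])
  moreover have "frac_int (\<alpha> - 1) (flux u) \<eta> \<le> frac_int (\<alpha> - 1) (flux u) 1"
    using \<alpha> \<eta> by (intro frac_int_mono_time continuous_on_flux u) (auto simp: flux_eq_powr[OF u])
  ultimately show ?thesis by (simp add: solution_op_def)
qed

lemma flux_diff_abs_le:
  assumes u: "continuous_on {0..1} u" and v: "continuous_on {0..1} v"
    and d: "\<And>s. s \<in> {0..1} \<Longrightarrow> \<bar>u s - v s\<bar> \<le> d" and t: "t \<in> {0..1}"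
  shows "\<bar>flux u t - flux v t\<bar>
    \<le> (q - 1) * integral {0..1} (\<lambda>t. a t * k t) powr (q - 2) * (L * integral {0..1} a) * d"
proof -
  have "0 \<le> d" using d[of 0] by simp
  have "\<bar>source u s - source v s\<bar> \<le> L * d * a s" if s: "s \<in> {0..1}" for s
  proof -
    have "\<bar>source u s - source v s\<bar> = a s * \<bar>f s (max 0 (u s)) - f s (max 0 (v s))\<bar>"
      using a_nonneg[OF s] by (simp add: source_def abs_mult flip: right_diff_distrib)
    also have "\<dots> \<le> a s * (L * \<bar>max 0 (u s) - max 0 (v s)\<bar>)"
      using s a_nonneg f_lipschitz by (intro mult_left_mono) auto
    \<comment> \<open>Truncation at 0 does not increase distances.\<close>
    also have "\<dots> \<le> a s * (L * d)"
      using s a_nonneg d[OF s] L_pos by (intro mult_left_mono) auto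
    finally show ?thesis by (simp add: mult_ac)
  qed
  then have "\<bar>integral {0..t} (\<lambda>s. source u s - source v s)\<bar> \<le> integral {0..t} (\<lambda>s. L * d * a s)"
    using t u v unfolding real_norm_def[symmetric]
    by (intro integral_norm_bound_integral integrable_sub01 continuous_intros continuous_on_source a_cont) auto
  also have "\<dots> = L * d * integral {0..t} a" by simp
  also have "\<dots> \<le> L * d * integral {0..1} a"
    using L_pos \<open>0 \<le> d\<close> t by (intro mult_left_mono integral_upto_le a_cont a_nonneg) auto
  finally have *: "\<bar>integral {0..t} (source u) - integral {0..t} (source v)\<bar> \<le> L * d * integral {0..1} a"
    using t u v by (simp add: integral_diff integrable_sub01 continuous_on_source)
  \<comment> \<open>The power estimate with exponent m = q - 1, which exceeds 1, on the common range
    of the integrated sources.\<close>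
  have "\<bar>flux u t - flux v t\<bar> \<le> (q - 1) * integral {0..1} (\<lambda>t. a t * k t) powr (q - 1 - 1)
      * \<bar>integral {0..t} (source u) - integral {0..t} (source v)\<bar>"
    unfolding flux_eq_powr[OF u t] flux_eq_powr[OF v t]
    using q_gt_2 t u v by (intro powr_diff_abs_le integral_source_bounds) auto
  also have "\<dots> \<le> (q - 1) * integral {0..1} (\<lambda>t. a t * k t) powr (q - 1 - 1) * (L * d * integral {0..1} a)"
    using * q_gt_2 by (intro mult_left_mono) auto
  finally show ?thesis by (simp add: mult_ac)
qed

lemma solution_op_diff_abs_le:
  assumes u: "continuous_on {0..1} u" and v: "continuous_on {0..1} v"
    and d: "\<And>s. s \<in> {0..1} \<Longrightarrow> \<bar>u s - v s\<bar> \<le> d" and t: "t \<in> {0..1}"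
  shows "\<bar>solution_op u t - solution_op v t\<bar> \<le> contraction_const * d"
proof -
  define e where "e = (q - 1) * integral {0..1} (\<lambda>t. a t * k t) powr (q - 2) * (L * integral {0..1} a) * d"
  \<comment> \<open>By linearity the difference of the operators consists of two increments of
    fractional integrals of \<open>w\<close>.\<close>
  define w where "w t = flux u t - flux v t" for t
  have w: "continuous_on {0..1} w" "\<And>t. t \<in> {0..1} \<Longrightarrow> \<bar>w t\<bar> \<le> e"
    unfolding w_def e_def
    by (auto intro!: continuous_intros continuous_on_flux u v flux_diff_abs_le d)
  have "\<alpha> \<notin> \<int>\<^sub>\<le>\<^sub>0" using \<alpha> by (auto elim!: nonpos_Ints_cases)
  then have G: "Gamma (\<alpha> + 1) = \<alpha> * Gamma \<alpha>" "Gamma \<alpha> > 0"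
    using \<alpha> by (auto intro!: Gamma_plus1 Gamma_real_pos)
  have diff: "frac_int b w s = frac_int b (flux u) s - frac_int b (flux v) s"
    if "0 < b" "s \<in> {0..1}" for b s
    unfolding w_def using that
    by (intro frac_int_diff continuous_on_subset[OF continuous_on_flux] u v) auto
  have "\<bar>frac_int \<alpha> w 1 - frac_int \<alpha> w t\<bar> \<le> e / Gamma (\<alpha> + 1)"
    using \<alpha> t w by (intro frac_int_increment_abs_le) auto
  moreover have "\<bar>frac_int (\<alpha> - 1) w 1 - frac_int (\<alpha> - 1) w \<eta>\<bar> \<le> e / Gamma (\<alpha> - 1 + 1)"
    using \<alpha> \<eta> w by (intro frac_int_increment_abs_le) auto
  moreover have "solution_op u t - solution_op v t = (frac_int \<alpha> w 1 - frac_int \<alpha> w t)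
      + (frac_int (\<alpha> - 1) w 1 - frac_int (\<alpha> - 1) w \<eta>)"
    using \<alpha> t \<eta> by (simp add: solution_op_def diff)
  ultimately have "\<bar>solution_op u t - solution_op v t\<bar> \<le> e / Gamma (\<alpha> + 1) + e / Gamma \<alpha>"
    by simp
  also have "\<dots> = (\<alpha> + 1) / Gamma (\<alpha> + 1) * e"
    using G(1) \<alpha> \<open>\<alpha> \<notin> \<int>\<^sub>\<le>\<^sub>0\<close> by (simp add: Gamma_eq_zero_iff field_simps)
  finally show ?thesis by (simp add: contraction_const_def e_def mult_ac)
qed

lemma flux_cong:
  assumes "\<And>s. s \<in> {0..1} \<Longrightarrow> u s = v s" "t \<in> {0..1}"
  shows "flux u t = flux v t"
  unfolding flux_def source_def using assms by (auto intro!: arg_cong[where f = "phi_lap q"] integral_cong)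

text \<open>Serves to compare a solution with its extension as a bounded continuous function, which
  agrees with it on [0,1] only.\<close>

lemma solution_op_cong:
  assumes "\<And>s. s \<in> {0..1} \<Longrightarrow> u s = v s" "t \<in> {0..1}"
  shows "solution_op u t = solution_op v t"
proof -
  have "frac_int b (flux u) r = frac_int b (flux v) r" if "r \<in> {0..1}" for b r
    using that assms by (intro frac_int_cong flux_cong) auto
  then show ?thesis using assms(2) \<eta> by (simp add: solution_op_def)
qed

section \<open>Equivalence of solutions and fixed points\<close>

lemma bvp_solution_imp_fixed_point:
  assumes sol: "bvp_solution p \<alpha> \<eta> a f u"
  shows "continuous_on {0..1} u" "\<And>t. t \<in> {0..1} \<Longrightarrow> solution_op u t = u t"
proof -
  note S = sol[unfolded bvp_solution_def]
  show u: "continuous_on {0..1} u"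
    using S by (auto simp: C2_01_def intro: differentiable_imp_continuous_on)
  define w where "w s = phi_lap p (caputo \<alpha> u s)" for s
  have w_cont: "continuous_on {0..1} w"
    unfolding w_def using S p by (intro continuous_on_phi_lap) auto
  have w0: "w 0 = 0" using S by (simp add: w_def phi_lap_def)
  have w': "(w has_vector_derivative - source u t) (at t)" if t: "t \<in> {0<..<1}" for t
  proof -
    have "w differentiable (at t)" "deriv w t = - (a t * f t (u t))" "0 \<le> u t"
      using S t by (auto simp: w_def[abs_def] add_eq_0_iff)
    \<comment> \<open>Solutions are nonnegative, so the truncation in \<open>source\<close> drops
      out.\<close>
    then have "deriv w t = - source u t" by (simp add: source_def)
    moreover have "(w has_field_derivative deriv w t) (at t)"
      using \<open>w differentiable (at t)\<close> by (auto simp: real_differentiable_def DERIV_imp_deriv)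
    ultimately show ?thesis by (simp add: has_real_derivative_iff_has_vector_derivative)
  qed
  have cap: "caputo \<alpha> u t = - flux u t" if t: "t \<in> {0..1}" for t
  proof -
    \<comment> \<open>The derivative of \<open>w\<close> is known on the open interval only;
      continuity of \<open>w\<close> covers the endpoints.\<close>
    have "((\<lambda>s. - source u s) has_integral w t - w 0) {0..t}"
      using t by (intro fundamental_theorem_of_calculus_interior w' continuous_on_subset[OF w_cont]) auto
    from integral_unique[OF this] have "w t = - integral {0..t} (source u)"
      using w0 by simp
    \<comment> \<open>The inversion lemma with p and q exchanged, whence q > 1 is required.\<close>
    moreover have "caputo \<alpha> u t = phi_lap q (w t)"
      unfolding w_def using q_gt_2 pq by (simp add: phi_lap_inverse add.commute)
    ultimately show ?thesis by (simp add: flux_def phi_lap_minus)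
  qed
  have neg: "frac_int b (\<lambda>t. - flux u t) s = - frac_int b (flux u) s" for b s
    using frac_int_cmult[of b "- 1" "flux u" s] by simp
  have g: "continuous_on {0..1} (\<lambda>t. - flux u t)"
    by (intro continuous_intros continuous_on_flux u)
  have bc: "C2_01 u" "deriv01 u 0 = 0" "deriv01 (deriv01 u) 0 = 0" "caputo_exists \<alpha> u"
    "u 1 + deriv01 u 1 = deriv01 u \<eta>"
    using S by auto
  note I = caputo_initial_value_imp[OF \<alpha> bc(1-4) g cap, unfolded neg]
  show "solution_op u t = u t" if "t \<in> {0..1}" for t
    using I(2)[OF _ that] I(1)[of \<eta>] I(1,2)[of 1] bc(5) \<eta> by (simp add: solution_op_def)
qed

lemma fixed_point_imp_bvp_solution:
  assumes u: "continuous_on {0..1} u" and fp: "\<And>t. t \<in> {0..1} \<Longrightarrow> solution_op u t = u t"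
  shows "bvp_solution p \<alpha> \<eta> a f u"
proof -
  define c where "c = frac_int \<alpha> (flux u) 1 + (frac_int (\<alpha> - 1) (flux u) 1 - frac_int (\<alpha> - 1) (flux u) \<eta>)"
  have neg: "frac_int b (\<lambda>t. - flux u t) s = - frac_int b (flux u) s" for b s
    using frac_int_cmult[of b "- 1" "flux u" s] by simp
  \<comment> \<open>Nonnegativity comes from the fixed point equation itself; it removes the
    truncation when the differential equation is recovered.\<close>
  have nonneg: "0 \<le> u t" if "t \<in> {0..1}" for t
    using solution_op_nonneg[OF u that] fp[OF that] by simp
  have g: "continuous_on {0..1} (\<lambda>t. - flux u t)"
    by (intro continuous_intros continuous_on_flux u)
  have ueq: "\<forall>t\<in>{0..1}. u t = c + frac_int \<alpha> (\<lambda>t. - flux u t) t"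
    using fp[symmetric] by (simp add: solution_op_def c_def neg)
  note I = caputo_initial_value_solution[OF \<alpha> g ueq]
  have cap_cont: "continuous_on {0..1} (caputo \<alpha> u)"
    using continuous_on_eq[OF g] I(3) by simp
  have w: "phi_lap p (caputo \<alpha> u s) = - integral {0..s} (source u)" if "s \<in> {0..1}" for s
    using I(3)[OF that] p pq by (simp add: flux_def phi_lap_minus phi_lap_inverse)
  have w': "((\<lambda>s. phi_lap p (caputo \<alpha> u s)) has_field_derivative - (a t * f t (u t))) (at t)"
    if t: "t \<in> {0<..<1}" for t
  proof -
    have "((\<lambda>s. integral {0..s} (source u)) has_vector_derivative source u t) (at t within {0..1})"
      using t by (intro integral_has_vector_derivative continuous_on_source u) auto
    then have "((\<lambda>s. - integral {0..s} (source u)) has_field_derivative - source u t) (at t)"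
      using t by (auto simp: at_within_Icc_at has_real_derivative_iff_has_vector_derivative
          intro!: derivative_eq_intros)
    \<comment> \<open>The two functions are known to agree on [0,1] only, so the derivative is
      transferred within the open interval.\<close>
    then have "((\<lambda>s. phi_lap p (caputo \<alpha> u s)) has_field_derivative - source u t) (at t)"
      by (rule has_field_derivative_transform_within_open[of _ _ _ "{0<..<1}"]) (use t w in auto)
    then show ?thesis using nonneg[of t] t by (simp add: source_def)
  qed
  show ?thesis
    unfolding bvp_solution_def
  proof (intro conjI ballI)
    show "(\<lambda>s. phi_lap p (caputo \<alpha> u s)) differentiable (at t)" if "t \<in> {0<..<1}" for t
      using w'[OF that] by (auto simp: real_differentiable_def)
    show "deriv (\<lambda>s. phi_lap p (caputo \<alpha> u s)) t + a t * f t (u t) = 0" if "t \<in> {0<..<1}" for t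
      using DERIV_imp_deriv[OF w'[OF that]] by simp
    show "caputo \<alpha> u 0 = 0" using I(3)[of 0] by (simp add: flux_def phi_lap_def)
    show "deriv01 u 0 = 0" "deriv01 (deriv01 u) 0 = 0" using I(4,5)[of 0] by simp_all
    show "u 1 + deriv01 u 1 = deriv01 u \<eta>"
      using ueq[rule_format, of 1] I(4)[of 1] I(4)[of \<eta>] \<eta> by (simp add: c_def neg)
  qed (use I(1,2) nonneg cap_cont in auto)
qed

text \<open>The Banach fixed point theorem in the sup metric gives existence, and any solution
  extends to a fixed point of the same map. Uniqueness is equality on [0,1], since values outside
  are unconstrained.\<close>

lemma ex1_bvp_solution:
  assumes "contraction_const < 1"
  shows "\<exists>u. bvp_solution p \<alpha> \<eta> a f u \<and>
           (\<forall>v. bvp_solution p \<alpha> \<eta> a f v \<longrightarrow> (\<forall>t\<in>{0..1}. v t = u t))"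
proof -
  define \<Phi> where "\<Phi> u = bcontfun01 (solution_op (apply_bcontfun u))" for u
  have \<Phi>: "apply_bcontfun (\<Phi> u) t = solution_op (apply_bcontfun u) (max 0 (min 1 t))" for u t
    unfolding \<Phi>_def by (intro bcontfun01_apply continuous_on_solution_op) simp
  have "dist (\<Phi> u) (\<Phi> v) \<le> contraction_const * dist u v" for u v
  proof (rule dist_bound)
    fix t
    show "dist (apply_bcontfun (\<Phi> u) t) (apply_bcontfun (\<Phi> v) t) \<le> contraction_const * dist u v"
      unfolding \<Phi> dist_real_def
      by (rule solution_op_diff_abs_le) (use dist_bounded[of u _ v] in \<open>auto simp: dist_real_def\<close>)
  qed
  moreover have "0 \<le> contraction_const"
    unfolding contraction_const_def using \<alpha> q_gt_2 L_pos a_nonneg a_cont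
    by (intro mult_nonneg_nonneg divide_nonneg_pos Gamma_real_pos integral_nonneg integrable_sub01) auto
  ultimately have "\<exists>!u. \<Phi> u = u"
    using assms by (intro banach_fix_type) auto
  then obtain U where U: "\<Phi> U = U" and unique: "\<And>V. \<Phi> V = V \<Longrightarrow> V = U" by blast
  have "solution_op (apply_bcontfun U) t = apply_bcontfun U t" if "t \<in> {0..1}" for t
    using \<Phi>[of U t] that by (simp add: U)
  then have "bvp_solution p \<alpha> \<eta> a f (apply_bcontfun U)"
    by (intro fixed_point_imp_bvp_solution) auto
  moreover have "v t = apply_bcontfun U t" if v: "bvp_solution p \<alpha> \<eta> a f v" and t: "t \<in> {0..1}" for v t
  proof -
    note F = bvp_solution_imp_fixed_point[OF v]
    have V: "apply_bcontfun (bcontfun01 v) s = v (max 0 (min 1 s))" for s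
      by (rule bcontfun01_apply[OF F(1)])
    \<comment> \<open>Both sides are constant beyond the endpoints, so the fixed point equation on
      [0,1] suffices.\<close>
    have "\<Phi> (bcontfun01 v) = bcontfun01 v"
    proof (rule bcontfun_eqI)
      fix s :: real
      have "solution_op (apply_bcontfun (bcontfun01 v)) (max 0 (min 1 s)) = solution_op v (max 0 (min 1 s))"
        by (rule solution_op_cong) (auto simp: V)
      then show "apply_bcontfun (\<Phi> (bcontfun01 v)) s = apply_bcontfun (bcontfun01 v) s"
        by (simp add: \<Phi> V F(2))
    qed
    from unique[OF this] V[of t] t show ?thesis by simp
  qed
  ultimately show ?thesis by blast
qed

end

section \<open>The bound on \<open>L\<close> as the contraction condition\<close>

theorem theorem3p4:
  fixes p q \<alpha> \<eta> L :: real
    and f :: "real \<Rightarrow> real \<Rightarrow> real"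
    and a k :: "real \<Rightarrow> real"
  assumes "1 < p" and "p < 2" and "1 / p + 1 / q = 1"
    and "2 < \<alpha>" and "\<alpha> \<le> 3"
    and "\<eta> \<in> {0<..<1}"
    and "continuous_on ({0..1} \<times> {0..}) (\<lambda>(t, u). f t u)"
    and "\<And>t u. t \<in> {0..1} \<Longrightarrow> 0 \<le> u \<Longrightarrow> 0 \<le> f t u"
    and "\<exists>t\<in>{0..1}. f t 0 \<noteq> 0"
    and "continuous_on {0..1} a"
    and "\<And>t. t \<in> {0..1} \<Longrightarrow> 0 \<le> a t"
    and "\<And>c d. 0 \<le> c \<Longrightarrow> c < d \<Longrightarrow> d \<le> 1 \<Longrightarrow> \<exists>t\<in>{c..d}. a t \<noteq> 0"
    and C1: "continuous_on {0..1} k"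
      "\<And>t. t \<in> {0..1} \<Longrightarrow> 0 \<le> k t"
      "\<And>t u. t \<in> {0..1} \<Longrightarrow> 0 \<le> u \<Longrightarrow> f t u \<le> k t"
    and C2: "0 < L"
      "L < Gamma (\<alpha> + 1) / ((\<alpha> + 1) * (q - 1))
             * inverse (integral {0..1} a)
             * (integral {0..1} (\<lambda>t. a t * k t)) powr (2 - q)"
      "\<And>t u v. t \<in> {0..1} \<Longrightarrow> 0 \<le> u \<Longrightarrow> 0 \<le> v \<Longrightarrow> \<bar>f t u - f t v\<bar> \<le> L * \<bar>u - v\<bar>"
  shows "\<exists>u. bvp_solution p \<alpha> \<eta> a f u \<and>
           (\<forall>v. bvp_solution p \<alpha> \<eta> a f v \<longrightarrow> (\<forall>t\<in>{0..1}. v t = u t))"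
proof -
  interpret laplacian_bvp p q \<alpha> \<eta> L f a k
    by unfold_locales (use assms in auto)
  define A where "A = integral {0..1} a"
  define K where "K = integral {0..1} (\<lambda>t. a t * k t)"
  have "0 \<le> A" unfolding A_def by (intro integral_nonneg integrable_sub01 a_cont) (auto simp: a_nonneg)
  \<comment> \<open>If A or K were 0, then \<open>inverse 0 = 0\<close> or
    \<open>0 powr (2 - q) = 0\<close> would make the upper bound for \<open>L\<close> equal to 0,
    against 0 < L.\<close>
  moreover have "A \<noteq> 0" "K \<noteq> 0" using C2(1,2) by (auto simp: A_def K_def)
  ultimately have pos: "0 < A" "0 < K powr (q - 2)" by auto
  \<comment> \<open>Chosen so that the hypothesis reads L < Gamma (\<alpha> + 1) / D, while
    \<open>contraction_const\<close> is L D / Gamma (\<alpha> + 1).\<close>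
  define D where "D = (\<alpha> + 1) * (q - 1) * A * K powr (q - 2)"
  have "0 < D" using pos \<alpha> q_gt_2 by (simp add: D_def)
  have "0 < Gamma (\<alpha> + 1)" using \<alpha> by (intro Gamma_real_pos) auto
  have "K powr (2 - q) = inverse (K powr (q - 2))" by (simp flip: powr_minus)
  then have "L < Gamma (\<alpha> + 1) / D"
    using C2(2) unfolding A_def[symmetric] K_def[symmetric] by (simp add: D_def divide_inverse mult_ac)
  then have "L * D < Gamma (\<alpha> + 1)" using \<open>0 < D\<close> by (simp add: pos_less_divide_eq)
  moreover have "contraction_const = L * D / Gamma (\<alpha> + 1)"
    unfolding contraction_const_def A_def[symmetric] K_def[symmetric] by (simp add: D_def)
  ultimately have "contraction_const < 1" using \<open>0 < Gamma (\<alpha> + 1)\<close> by simp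
  then show ?thesis by (rule ex1_bvp_solution)
qed

end
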